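(* Let $\bar L$ be a birth and death generator on $\mathbb{Z}_+$, absorbing at $0$ and irreducible on $\mathbb{N}=\{1,2,3,\dots\}$. Assume on one hand that there exists $x\in\mathbb{N}$ such that $\tau^x_0$ is a.s. finite, namely the process $X^x$ a.s. ends up being absorbed at $0$. Then this is true for all $x\in\mathbb{Z}_+$. Assume on the other hand that there exist a positive number $\lambda>0$ and a positive function $\varphi$ on $\mathbb{N}$, with finite amplitude $a_\varphi:=\sup_{\mathbb{N}}\varphi/\inf_{\mathbb{N}}\varphi<+\infty$, which satisfy $K[\varphi]\le-\lambda\varphi$ on $\mathbb{N}$. Then (under both assumptions) $\infty$ is an entrance boundary for $\bar L$.
   Context: $\mathbb{Z}_+=\{0,1,2,\dots\}$, $\mathbb{N}=\{1,2,3,\dots\}$. The generator $\bar L$ is given by $\bar L(x,x+1)=b_x$, $\bar L(x,x-1)=d_x$ (for $x\ge1$), $\bar L(x,x)=-d_x-b_x$ (with $d_0=0$), and $\bar L(x,y)=0$ otherwise, where $b_x>0$ and $d_x>0$ for all $x\in\mathbb{N}$, and $b_0=0$ (so $0$ is absorbing). For a function $\varphi$ on $\mathbb{N}$, $K[\varphi](x):=b_x(\varphi(x+1)-\varphi(x))+d_x(\varphi(x-1)-\varphi(x))$ for $x\in\mathbb{N}$, with the convention $\varphi(0)=0$. For $x\in\mathbb{Z}_+$, $X^x=(X^x_t)_{0\le t<\sigma_\infty}$ is the minimal Markov jump process starting from $x$ associated with $\bar L$: at a state $z\neq0$ it waits an exponential time of parameter $|\bar L(z,z)|$, then jumps to $y\ne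 z$ with probability $\bar L(z,y)/|\bar L(z,z)|$ (all random variables being conditionally independent); it stays forever at $0$ once it is reached. $\sigma_\infty$ is the explosion time, i.e. the limit of the successive jump times, with $\sigma_\infty=+\infty$ if $0$ is reached. For $y\in\mathbb{Z}_+$, $\tau^x_y:=\inf\{t\ge 0: X^x_t=y\}$ (over $t<\sigma_\infty$), equal to $+\infty$ if $y$ is never reached. Define $\pi_1:=1$ and $\pi_x:=\dfrac{b_1b_2\cdots b_{x-1}}{d_2d_3\cdots d_x}$ for $x\ge2$. The boundary point $\infty$ is an entrance boundary for $\bar L$ if $$\sum_{x=1}^\infty\frac1{\pi_xb_x}\sum_{y=1}^x\pi_y=+\infty\quad\text{and}\quad\sum_{x=1}^\infty\frac1{\pi_xb_x}\sum_{y=x+1}^\infty\pi_y<+\infty.$$ *)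

theory Defs
  imports "HOL-Probability.Probability"
begin

definition birth_death_rates :: "(nat \<Rightarrow> real) \<Rightarrow> (nat \<Rightarrow> real) \<Rightarrow> bool" where
  "birth_death_rates b d \<longleftrightarrow> b 0 = 0 \<and> d 0 = 0 \<and> (\<forall>x\<ge>1. b x > 0 \<and> d x > 0)"

definition bd_generator :: "(nat \<Rightarrow> real) \<Rightarrow> (nat \<Rightarrow> real) \<Rightarrow> nat \<Rightarrow> nat \<Rightarrow> real" where
  "bd_generator b d x y =
     (if y = x + 1 then b x
      else if x \<ge> 1 \<and> y = x - 1 then d x
      else if y = x then - d x - b x
      else 0)"

text \<open>
  A jump process is encoded by its embedded chain \<open>Y\<close> (\<open>Y n\<close> is the state after \<open>n\<close> jumps) and
  its holding times \<open>H\<close> (\<open>H n\<close> is the time spent in \<open>Y n\<close>). In an absorbing state the holding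
  time is \<open>\<infinity>\<close>, and by convention the embedded chain then stays where it is.
\<close>

definition jump_prob :: "(nat \<Rightarrow> nat \<Rightarrow> real) \<Rightarrow> nat \<Rightarrow> nat \<Rightarrow> real" where
  "jump_prob Q z y =
     (if Q z z = 0 then (if y = z then 1 else 0)
      else if y = z then 0 else Q z y / \<bar>Q z z\<bar>)"

text \<open>The sigma-algebra generated by \<open>Y 0, \<dots>, Y n\<close> and \<open>H 0, \<dots>, H (n - 1)\<close>:\<close>

definition jump_history ::
    "'w measure \<Rightarrow> (nat \<Rightarrow> 'w \<Rightarrow> nat) \<Rightarrow> (nat \<Rightarrow> 'w \<Rightarrow> ennreal) \<Rightarrow> nat \<Rightarrow> 'w set set" where
  "jump_history M Y H n =
     sigma_sets (space M)
       ({{w \<in> space M. Y k w = z} | k z. k \<le> n} \<union>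
        {{w \<in> space M. H k w > t} | k t. k < n})"

text \<open>
  Given the past and \<open>Y n = z\<close>, the holding time \<open>H n\<close> is exponential with parameter
  \<open>\<bar>Q z z\<bar>\<close> (almost surely \<open>\<infinity>\<close> if \<open>Q z z = 0\<close>), the next state has law \<open>jump_prob Q z\<close>, and
  the two are independent.
\<close>

definition minimal_jump_process ::
    "'w measure \<Rightarrow> (nat \<Rightarrow> nat \<Rightarrow> real) \<Rightarrow> nat \<Rightarrow>
     (nat \<Rightarrow> 'w \<Rightarrow> nat) \<Rightarrow> (nat \<Rightarrow> 'w \<Rightarrow> ennreal) \<Rightarrow> bool" where
  "minimal_jump_process M Q x Y H \<longleftrightarrow>
     prob_space M \<and>
     (\<forall>n. Y n \<in> measurable M (count_space UNIV)) \<and>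
     (\<forall>n. H n \<in> borel_measurable M) \<and>
     (AE w in M. Y 0 w = x) \<and>
     (\<forall>n z y. \<forall>t\<ge>0. \<forall>A\<in>jump_history M Y H n.
        measure M (A \<inter> {w \<in> space M. Y n w = z \<and> H n w > ennreal t \<and> Y (Suc n) w = y}) =
        measure M (A \<inter> {w \<in> space M. Y n w = z}) * exp (- \<bar>Q z z\<bar> * t) * jump_prob Q z y)"

definition jump_time :: "(nat \<Rightarrow> 'w \<Rightarrow> ennreal) \<Rightarrow> nat \<Rightarrow> 'w \<Rightarrow> ennreal" where
  "jump_time H n w = (\<Sum>k<n. H k w)"

definition explosion_time :: "(nat \<Rightarrow> 'w \<Rightarrow> ennreal) \<Rightarrow> 'w \<Rightarrow> ennreal" where
  "explosion_time H w = (SUP n. jump_time H n w)"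

text \<open>The position at time \<open>t\<close>; only meaningful for \<open>t < explosion_time H w\<close>.\<close>

definition jump_path ::
    "(nat \<Rightarrow> 'w \<Rightarrow> nat) \<Rightarrow> (nat \<Rightarrow> 'w \<Rightarrow> ennreal) \<Rightarrow> ennreal \<Rightarrow> 'w \<Rightarrow> nat" where
  "jump_path Y H t w = Y (LEAST n. t < jump_time H (Suc n) w) w"

definition hitting_time ::
    "(nat \<Rightarrow> 'w \<Rightarrow> nat) \<Rightarrow> (nat \<Rightarrow> 'w \<Rightarrow> ennreal) \<Rightarrow> nat \<Rightarrow> 'w \<Rightarrow> ennreal" where
  "hitting_time Y H y w = Inf {t. t < explosion_time H w \<and> jump_path Y H t w = y}"

text \<open>
  Functions on the positive integers are represented by functions on \<^typ>\<open>nat\<close> whose value at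
  \<open>0\<close> is ignored; the update \<open>\<phi>(0 := 0)\<close> implements the convention \<open>\<phi> 0 = 0\<close>.
\<close>

definition bd_operator ::
    "(nat \<Rightarrow> real) \<Rightarrow> (nat \<Rightarrow> real) \<Rightarrow> (nat \<Rightarrow> real) \<Rightarrow> nat \<Rightarrow> real" where
  "bd_operator b d \<phi> x =
     (let \<psi> = \<phi>(0 := 0) in b x * (\<psi> (x + 1) - \<psi> x) + d x * (\<psi> (x - 1) - \<psi> x))"

text \<open>
  In \<^typ>\<open>ereal\<close> the amplitude of a positive function is \<open>\<infinity>\<close> when its supremum is \<open>\<infinity>\<close> or its
  infimum is \<open>0\<close>.
\<close>

definition amplitude :: "(nat \<Rightarrow> real) \<Rightarrow> ereal" where
  "amplitude \<phi> = (SUP x\<in>{1..}. ereal (\<phi> x)) / (INF x\<in>{1..}. ereal (\<phi> x))"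

definition bd_weight :: "(nat \<Rightarrow> real) \<Rightarrow> (nat \<Rightarrow> real) \<Rightarrow> nat \<Rightarrow> real" where
  "bd_weight b d x = (\<Prod>k=1..<x. b k) / (\<Prod>k=2..x. d k)"

text \<open>The outer sums range over \<open>x = Suc n \<ge> 1\<close>, the tail sum over \<open>y = x + 1 + k\<close>.\<close>

definition entrance_boundary :: "(nat \<Rightarrow> real) \<Rightarrow> (nat \<Rightarrow> real) \<Rightarrow> bool" where
  "entrance_boundary b d \<longleftrightarrow>
     (\<Sum>n. let x = Suc n in
        ennreal (1 / (bd_weight b d x * b x)) * (\<Sum>y=1..x. ennreal (bd_weight b d y))) = \<infinity> \<and>
     (\<Sum>n. let x = Suc n in
        ennreal (1 / (bd_weight b d x * b x)) * (\<Sum>k. ennreal (bd_weight b d (x + 1 + k)))) < \<infinity>"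

end

theory Submission imports Defs begin

text \<open>
  Whether \<open>0\<close> is reached depends on the embedded chain only: a holding time at \<open>z \<ge> 1\<close> is
  exponential, hence finite, and the one at \<open>0\<close> is infinite, so the chain reaches \<open>0\<close> exactly when
  the process does, at a time before explosion (\<open>AE_hitting_time_finite_iff\<close>). The law of the
  chain is obtained by iterating its jump kernel.

  Let \<open>u x\<close> be the probability that the chain started at \<open>x\<close> never reaches \<open>0\<close>. Then \<open>u\<close> is
  harmonic and vanishes at \<open>0\<close>. The equation \<open>K[u] = 0\<close> is a two-term recursion for the
  increments of \<open>u\<close>, so the harmonic functions vanishing at \<open>0\<close> form a line, spanned by the scale
  function, whose increments are proportional to \<open>1 / (\<pi>\<^sub>x b\<^sub>x)\<close> (\<open>harmonic_unique\<close>). As the scale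
  function is positive on the positive integers, \<open>u x = 0\<close> at a single \<open>x \<ge> 1\<close> forces \<open>u = 0\<close>
  everywhere: absorption that is certain from one positive state is certain from every state. Moreover
  the scale function is then unbounded, because dividing it by an upper bound would give a harmonic
  minorant of \<open>u\<close> (\<open>absorption_dichotomy\<close>). In other words \<open>\<Sum> 1 / (\<pi>\<^sub>x b\<^sub>x) = \<infinity>\<close>, which gives the
  first half of the entrance criterion since \<open>\<Sum>\<^sub>y \<pi>\<^sub>y \<ge> \<pi>\<^sub>1 = 1\<close>.

  For the second half, consider the flux \<open>w x = \<pi>\<^sub>x b\<^sub>x (\<phi> (x + 1) - \<phi> x)\<close>. By detailed balance
  \<open>w x - w (x - 1) = \<pi>\<^sub>x K[\<phi>] x \<le> - \<lambda> (inf \<phi>) \<pi>\<^sub>x\<close> for \<open>x \<ge> 2\<close>, so \<open>w\<close> decreases. It cannot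
  become negative: otherwise \<open>\<phi>\<close> would eventually decrease at least as fast as a multiple of the
  divergent series \<open>\<Sum> 1 / (\<pi>\<^sub>x b\<^sub>x)\<close>, and lose its positivity. Summing the inequality from \<open>x + 1\<close> on
  therefore bounds \<open>\<lambda> (inf \<phi>) \<Sum>\<^sub>y\<^sub>>\<^sub>x \<pi>\<^sub>y\<close> by \<open>w x\<close>. Dividing by \<open>\<pi>\<^sub>x b\<^sub>x\<close> turns \<open>w x\<close> into an
  increment of \<open>\<phi>\<close>, and the sum over \<open>x\<close> telescopes to at most \<open>(sup \<phi> - inf \<phi>) / (\<lambda> inf \<phi>)\<close>
  (\<open>entrance_sum_finite\<close>).
\<close>

section \<open>Jump processes and their embedded chain\<close>

primrec chain_law :: "('a \<Rightarrow> 'a pmf) \<Rightarrow> nat \<Rightarrow> 'a \<Rightarrow> 'a pmf" where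
  "chain_law \<kappa> 0 x = return_pmf x"
| "chain_law \<kappa> (Suc n) x = bind_pmf (chain_law \<kappa> n x) \<kappa>"

text \<open>
  The law is defined by its last step, which fits the step-by-step description of the process.
  Harmonic functions arise from conditioning on the first step instead.
\<close>

lemma chain_law_Suc_first_step:
  "chain_law \<kappa> (Suc n) x = bind_pmf (\<kappa> x) (chain_law \<kappa> n)"
proof (induction n)
  case 0
  show ?case by (simp add: bind_return_pmf bind_return_pmf')
next
  case (Suc n)
  have "chain_law \<kappa> (Suc (Suc n)) x = bind_pmf (bind_pmf (\<kappa> x) (chain_law \<kappa> n)) \<kappa>"
    using Suc.IH by simp
  then show ?case by (simp add: bind_assoc_pmf)
qed

lemma emeasure_split_by_state:
  fixes Z :: "'w \<Rightarrow> nat"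
  assumes [measurable]: "Z \<in> measurable M (count_space UNIV)" and P: "{w \<in> space M. P w} \<in> sets M"
  shows "emeasure M {w \<in> space M. P w} = (\<Sum>z. emeasure M {w \<in> space M. P w \<and> Z w = z})"
proof -
  have [measurable]: "Measurable.pred M P" using P by (simp add: pred_def)
  have "(\<Sum>z. emeasure M {w \<in> space M. P w \<and> Z w = z}) =
      emeasure M (\<Union>z. {w \<in> space M. P w \<and> Z w = z})"
    by (rule suminf_emeasure) (auto simp: disjoint_family_on_def)
  also have "(\<Union>z. {w \<in> space M. P w \<and> Z w = z}) = {w \<in> space M. P w}" by auto
  finally show ?thesis by simp
qed

lemma suminf_ennreal_pmf: "(\<Sum>z. ennreal (pmf p z)) = 1" for p :: "nat pmf"
proof -
  have "(\<Sum>z. ennreal (pmf p z)) = (\<integral>\<^sup>+ z. ennreal (pmf p z) \<partial>count_space UNIV)"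
    by (simp add: nn_integral_count_space_nat)
  also have "\<dots> = 1" by (simp add: nn_integral_pmf)
  finally show ?thesis .
qed

lemma (in prob_space) AE_of_prob_eq:
  assumes "{w \<in> space M. P w \<and> R w} \<in> sets M" "{w \<in> space M. P w} \<in> sets M"
    and "prob {w \<in> space M. P w \<and> R w} = prob {w \<in> space M. P w}"
  shows "AE w in M. P w \<longrightarrow> R w"
proof -
  have "prob ({w \<in> space M. P w} - {w \<in> space M. P w \<and> R w}) = 0"
    using assms by (subst finite_measure_Diff) auto
  moreover have "{w \<in> space M. P w} - {w \<in> space M. P w \<and> R w} = {w \<in> space M. \<not> (P w \<longrightarrow> R w)}"
    by auto
  moreover have "{w \<in> space M. P w} - {w \<in> space M. P w \<and> R w} \<in> sets M"
    using assms by auto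
  ultimately show ?thesis
    by (intro AE_I[of _ _ "{w \<in> space M. \<not> (P w \<longrightarrow> R w)}"]) (auto simp: emeasure_eq_measure)
qed

lemma hitting_time_finite_iff:
  "hitting_time Y H z w < \<infinity> \<longleftrightarrow> (\<exists>t<explosion_time H w. jump_path Y H t w = z)"
proof
  assume "hitting_time Y H z w < \<infinity>"
  then show "\<exists>t<explosion_time H w. jump_path Y H t w = z"
    unfolding hitting_time_def Inf_less_iff by blast
next
  assume "\<exists>t<explosion_time H w. jump_path Y H t w = z"
  then obtain t where t: "t < explosion_time H w" "jump_path Y H t w = z" by blast
  then have "hitting_time Y H z w \<le> t"
    unfolding hitting_time_def by (intro Inf_lower) simp
  also have "t < \<infinity>" using t(1) by (auto intro: less_le_trans)
  finally show "hitting_time Y H z w < \<infinity>" .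
qed

locale jump_process =
  fixes M :: "'w measure" and Q :: "nat \<Rightarrow> nat \<Rightarrow> real" and x :: nat
    and Y :: "nat \<Rightarrow> 'w \<Rightarrow> nat" and H :: "nat \<Rightarrow> 'w \<Rightarrow> ennreal"
    and \<kappa> :: "nat \<Rightarrow> nat pmf"
  assumes process: "minimal_jump_process M Q x Y H"
    and kernel: "\<And>z y. pmf (\<kappa> z) y = jump_prob Q z y"
begin

sublocale prob_space M
  using process by (simp add: minimal_jump_process_def)

lemma measurable_Y [measurable]: "Y n \<in> measurable M (count_space UNIV)"
  and measurable_H [measurable]: "H n \<in> borel_measurable M"
  and start: "AE w in M. Y 0 w = x"
  using process by (simp_all add: minimal_jump_process_def)

lemma prob_step:
  assumes "t \<ge> 0"
  shows "prob {w \<in> space M. Y n w = z \<and> H n w > ennreal t \<and> Y (Suc n) w = y} =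
    prob {w \<in> space M. Y n w = z} * exp (- \<bar>Q z z\<bar> * t) * pmf (\<kappa> z) y"
proof -
  have "space M \<in> jump_history M Y H n"
    unfolding jump_history_def by (rule sigma_sets_top)
  then have "prob (space M \<inter> {w \<in> space M. Y n w = z \<and> H n w > ennreal t \<and> Y (Suc n) w = y}) =
      prob (space M \<inter> {w \<in> space M. Y n w = z}) * exp (- \<bar>Q z z\<bar> * t) * pmf (\<kappa> z) y"
    using process assms unfolding minimal_jump_process_def kernel by blast
  moreover have "space M \<inter> {w \<in> space M. P w} = {w \<in> space M. P w}" for P by auto
  ultimately show ?thesis by simp
qed

text \<open>
  The next state is summed out: it takes some value with total probability \<open>1\<close>.
\<close>

lemma prob_holding_time_gt:
  assumes "t \<ge> 0"
  shows "prob {w \<in> space M. Y n w = z \<and> H n w > ennreal t} =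
    prob {w \<in> space M. Y n w = z} * exp (- \<bar>Q z z\<bar> * t)"
proof -
  let ?c = "prob {w \<in> space M. Y n w = z} * exp (- \<bar>Q z z\<bar> * t)"
  have "emeasure M {w \<in> space M. Y n w = z \<and> H n w > ennreal t} =
      (\<Sum>y. emeasure M {w \<in> space M. (Y n w = z \<and> H n w > ennreal t) \<and> Y (Suc n) w = y})"
    by (rule emeasure_split_by_state) measurable
  also have "\<dots> = (\<Sum>y. ennreal ?c * ennreal (pmf (\<kappa> z) y))"
    using prob_step[OF assms, of n z]
    by (simp add: emeasure_eq_measure ennreal_mult')
  also have "\<dots> = ennreal ?c"
    by (simp add: suminf_ennreal_pmf)
  finally show ?thesis
    by (simp add: emeasure_eq_measure)
qed

text \<open>
  This is the case \<open>t = 0\<close> of \<open>prob_holding_time_gt\<close>. It allows the event \<open>H n > 0\<close> to be dropped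
  from \<open>prob_step\<close>, which then describes the embedded chain alone.
\<close>

lemma holding_time_pos: "AE w in M. H n w > 0"
proof -
  have "AE w in M. Y n w = z \<longrightarrow> H n w > 0" for z
    by (rule AE_of_prob_eq) (use prob_holding_time_gt[of 0 n z] in simp_all)
  then have "AE w in M. \<forall>z. Y n w = z \<longrightarrow> H n w > 0"
    unfolding AE_all_countable by blast
  then show ?thesis by simp
qed

lemma holding_time_absorbing:
  assumes "Q z z = 0"
  shows "AE w in M. Y n w = z \<longrightarrow> H n w = \<infinity>"
proof -
  have "AE w in M. Y n w = z \<longrightarrow> H n w > ennreal (real k)" for k
    by (rule AE_of_prob_eq) (use prob_holding_time_gt[of "real k" n z] assms in simp_all)
  then have "AE w in M. \<forall>k. Y n w = z \<longrightarrow> H n w > ennreal (real k)"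
    unfolding AE_all_countable by blast
  then show ?thesis
  proof eventually_elim
    case (elim w)
    show ?case
    proof
      assume "Y n w = z"
      then have "of_nat k < H n w" for k
        using elim by (simp add: ennreal_of_nat_eq_real_of_nat)
      then show "H n w = \<infinity>"
        by (metis ennreal_Ex_less_of_nat infinity_ennreal_def less_asym top.not_eq_extremum)
    qed
  qed
qed

lemma holding_time_finite:
  assumes "Q z z \<noteq> 0"
  shows "AE w in M. Y n w = z \<longrightarrow> H n w < \<infinity>"
proof -
  let ?B = "{w \<in> space M. Y n w = z \<and> H n w = \<infinity>}"
  have "prob ?B \<le> prob {w \<in> space M. Y n w = z} * exp (- \<bar>Q z z\<bar> * real k)" for k
    by (subst prob_holding_time_gt[symmetric])
      (auto simp: less_top[symmetric] intro!: finite_measure_mono)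
  moreover have "(\<lambda>k. prob {w \<in> space M. Y n w = z} * exp (- \<bar>Q z z\<bar> * real k)) \<longlonglongrightarrow> 0"
  proof -
    have "(\<lambda>k. exp (- \<bar>Q z z\<bar>) ^ k) \<longlonglongrightarrow> 0"
      by (rule LIMSEQ_realpow_zero) (use assms in auto)
    then have "(\<lambda>k. prob {w \<in> space M. Y n w = z} * exp (- \<bar>Q z z\<bar>) ^ k) \<longlonglongrightarrow> 0"
      by (rule tendsto_mult_right_zero)
    then show ?thesis by (simp only: exp_of_nat2_mult)
  qed
  ultimately have "prob ?B \<le> 0"
    by (intro LIMSEQ_le_const) auto
  then have "emeasure M ?B = 0"
    by (simp add: emeasure_eq_measure measure_le_0_iff)
  then show ?thesis
    by (intro AE_I[of _ _ ?B]) (auto simp: less_top[symmetric])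
qed

lemma prob_jump:
  "prob {w \<in> space M. Y n w = z \<and> Y (Suc n) w = y} =
    prob {w \<in> space M. Y n w = z} * pmf (\<kappa> z) y"
proof -
  have "prob {w \<in> space M. Y n w = z \<and> Y (Suc n) w = y} =
      prob {w \<in> space M. Y n w = z \<and> H n w > ennreal 0 \<and> Y (Suc n) w = y}"
    by (rule finite_measure_eq_AE) (use holding_time_pos[of n] in auto)
  then show ?thesis using prob_step[of 0 n z y] by simp
qed

lemma prob_embedded_chain: "prob {w \<in> space M. Y n w = y} = pmf (chain_law \<kappa> n x) y"
proof (induction n arbitrary: y)
  case 0
  have "prob {w \<in> space M. Y 0 w = y} = prob {w \<in> space M. x = y}"
    by (rule finite_measure_eq_AE) (use start in auto)
  then show ?case by (simp add: prob_space indicator_def)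
next
  case (Suc n)
  have "emeasure M {w \<in> space M. Y (Suc n) w = y} =
      (\<Sum>z. emeasure M {w \<in> space M. Y (Suc n) w = y \<and> Y n w = z})"
    by (rule emeasure_split_by_state) measurable
  also have "\<dots> = (\<Sum>z. ennreal (pmf (chain_law \<kappa> n x) z) * ennreal (pmf (\<kappa> z) y))"
    using Suc.IH prob_jump[of n _ y]
    by (simp add: emeasure_eq_measure ennreal_mult' conj_commute)
  also have "\<dots> = (\<integral>\<^sup>+ z. ennreal (pmf (\<kappa> z) y) \<partial>measure_pmf (chain_law \<kappa> n x))"
    by (simp add: nn_integral_measure_pmf nn_integral_count_space_nat)
  also have "\<dots> = ennreal (pmf (chain_law \<kappa> (Suc n) x) y)"
    by (simp add: ennreal_pmf_bind)
  finally show ?case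
    by (simp add: emeasure_eq_measure)
qed

lemma absorbed_forever:
  assumes "Q z z = 0"
  shows "AE w in M. \<forall>k n. k \<le> n \<longrightarrow> Y k w = z \<longrightarrow> Y n w = z"
proof -
  have "AE w in M. Y n w = z \<longrightarrow> Y (Suc n) w = z" for n
    by (rule AE_of_prob_eq) (use assms in \<open>simp_all add: prob_jump kernel jump_prob_def\<close>)
  then have "AE w in M. \<forall>n. Y n w = z \<longrightarrow> Y (Suc n) w = z"
    by (simp add: AE_all_countable)
  then show ?thesis
  proof eventually_elim
    case (elim w)
    have "Y n w = z" if "k \<le> n" "Y k w = z" for k n
      using that by (induction n rule: dec_induct) (use elim in auto)
    then show ?case by blast
  qed
qed

text \<open>
  Since the chain does not leave an absorbing \<open>z\<close>, having visited \<open>z\<close> by time \<open>n\<close> is almost surely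
  the same as being at \<open>z\<close> at time \<open>n\<close>; continuity from below concludes.
\<close>

lemma AE_reaches_iff:
  assumes "Q z z = 0"
  shows "(AE w in M. \<exists>n. Y n w = z) \<longleftrightarrow> (\<lambda>n. pmf (chain_law \<kappa> n x) z) \<longlonglongrightarrow> 1"
proof -
  let ?B = "\<lambda>n. {w \<in> space M. \<exists>k\<le>n. Y k w = z}"
  have "prob (?B n) = pmf (chain_law \<kappa> n x) z" for n
    unfolding prob_embedded_chain[symmetric]
    by (rule finite_measure_eq_AE) (use absorbed_forever[OF assms] in auto)
  moreover have "(\<lambda>n. prob (?B n)) \<longlonglongrightarrow> prob (\<Union>n. ?B n)"
    by (rule finite_Lim_measure_incseq) (auto simp: incseq_def intro: order_trans)
  ultimately have lim: "(\<lambda>n. pmf (chain_law \<kappa> n x) z) \<longlonglongrightarrow> prob (\<Union>n. ?B n)"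
    by simp
  have "(AE w in M. \<exists>n. Y n w = z) \<longleftrightarrow> (AE w in M. w \<in> (\<Union>n. ?B n))"
    by (intro AE_cong) auto
  also have "\<dots> \<longleftrightarrow> prob (\<Union>n. ?B n) = 1"
    by (rule AE_in_set_eq_1) measurable
  finally show ?thesis
    using lim LIMSEQ_unique by auto
qed

text \<open>
  If the chain first reaches \<open>z\<close> after \<open>n\<close> jumps, then these jumps take a finite time, and the
  infinite holding time that follows rules out explosion. So \<open>z\<close> is the position at the time of the
  \<open>n\<close>-th jump.
\<close>

lemma AE_hitting_time_finite_iff:
  assumes "Q z z = 0" and "\<And>y. y \<noteq> z \<Longrightarrow> Q y y \<noteq> 0"
  shows "(AE w in M. hitting_time Y H z w < \<infinity>) \<longleftrightarrow> (\<lambda>n. pmf (chain_law \<kappa> n x) z) \<longlonglongrightarrow> 1"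
proof -
  have "AE w in M. \<forall>n. Y n w = z \<longrightarrow> H n w = \<infinity>"
    using holding_time_absorbing[OF assms(1)] by (simp add: AE_all_countable)
  moreover have "AE w in M. \<forall>n y. y \<noteq> z \<longrightarrow> Y n w = y \<longrightarrow> H n w < \<infinity>"
    unfolding AE_all_countable using holding_time_finite[OF assms(2)] by auto
  ultimately have "AE w in M. hitting_time Y H z w < \<infinity> \<longleftrightarrow> (\<exists>n. Y n w = z)"
  proof eventually_elim
    case (elim w)
    show ?case
    proof
      assume "hitting_time Y H z w < \<infinity>"
      then show "\<exists>n. Y n w = z"
        unfolding hitting_time_finite_iff jump_path_def by blast
    next
      assume "\<exists>n. Y n w = z"
      define n where "n = (LEAST n. Y n w = z)"
      have n: "Y n w = z"
        unfolding n_def using \<open>\<exists>n. Y n w = z\<close> by (rule LeastI_ex)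
      have before: "H k w < \<infinity>" if "k < n" for k
        using not_less_Least[of k "\<lambda>n. Y n w = z"] that elim(2) by (auto simp: n_def)
      \<comment> \<open>the instant at which \<open>z\<close> is first reached\<close>
      define t where "t = jump_time H n w"
      have "t < \<infinity>"
        using before by (simp add: t_def jump_time_def)
      have jump: "jump_time H (Suc n) w = \<infinity>"
        using elim(1) n by (simp add: jump_time_def)
      have "(LEAST m. t < jump_time H (Suc m) w) = n"
      proof (rule Least_equality)
        show "t < jump_time H (Suc n) w" using jump \<open>t < \<infinity>\<close> by simp
      next
        fix m assume m: "t < jump_time H (Suc m) w"
        show "n \<le> m"
        proof (rule ccontr)
          assume "\<not> n \<le> m"
          then have "jump_time H (Suc m) w \<le> t"
            unfolding t_def jump_time_def by (intro sum_mono2) auto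
          with m show False by simp
        qed
      qed
      then have "jump_path Y H t w = z"
        by (simp add: jump_path_def n)
      moreover have "t < explosion_time H w"
      proof -
        have "jump_time H (Suc n) w \<le> explosion_time H w"
          unfolding explosion_time_def by (rule SUP_upper) simp
        with jump \<open>t < \<infinity>\<close> show ?thesis by (metis less_le_trans)
      qed
      ultimately show "hitting_time Y H z w < \<infinity>"
        unfolding hitting_time_finite_iff by blast
    qed
  qed
  then have "(AE w in M. hitting_time Y H z w < \<infinity>) \<longleftrightarrow> (AE w in M. \<exists>n. Y n w = z)"
    by auto
  then show ?thesis
    using AE_reaches_iff[OF assms(1)] by simp
qed

end

section \<open>Birth and death chains\<close>

locale birth_death =
  fixes b d :: "nat \<Rightarrow> real"
  assumes rates: "birth_death_rates b d"
begin

lemma birth_pos: "x \<ge> 1 \<Longrightarrow> b x > 0"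
  and death_pos: "x \<ge> 1 \<Longrightarrow> d x > 0"
  and rates_0: "b 0 = 0" "d 0 = 0"
  using rates by (simp_all add: birth_death_rates_def)

definition jump_kernel :: "nat \<Rightarrow> nat pmf" where
  "jump_kernel x = (if x = 0 then return_pmf 0
     else map_pmf (\<lambda>up. if up then x + 1 else x - 1) (bernoulli_pmf (b x / (b x + d x))))"

lemma expectation_kernel:
  fixes f :: "nat \<Rightarrow> real"
  assumes "x \<ge> 1"
  shows "measure_pmf.expectation (jump_kernel x) f =
    (b x * f (x + 1) + d x * f (x - 1)) / (b x + d x)"
proof -
  have p: "0 \<le> b x / (b x + d x)" "b x / (b x + d x) \<le> 1"
    using birth_pos[OF assms] death_pos[OF assms] by (auto simp: divide_simps)
  have "1 - b x / (b x + d x) = d x / (b x + d x)"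
    using birth_pos[OF assms] death_pos[OF assms] by (simp add: field_simps)
  then show ?thesis
    using assms p by (simp add: jump_kernel_def add_divide_distrib mult.commute)
qed

lemma pmf_kernel: "pmf (jump_kernel z) y = jump_prob (bd_generator b d) z y"
proof (cases "z = 0")
  case True
  then show ?thesis
    by (simp add: jump_kernel_def jump_prob_def bd_generator_def rates_0)
next
  case False
  then have z: "z \<ge> 1" by simp
  have "pmf (jump_kernel z) y = measure_pmf.expectation (jump_kernel z) (indicator {y})"
    by (simp add: pmf.rep_eq)
  also have "\<dots> = (b z * indicator {y} (z + 1) + d z * indicator {y} (z - 1)) / (b z + d z)"
    by (rule expectation_kernel[OF z])
  moreover have "\<bar>- d z - b z\<bar> = b z + d z" "- d z - b z \<noteq> 0"
    using birth_pos[OF z] death_pos[OF z] by simp_all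
  ultimately show ?thesis
    using z
    by (auto simp: jump_prob_def bd_generator_def indicator_def)
qed

abbreviation weight :: "nat \<Rightarrow> real" where "weight \<equiv> bd_weight b d"

lemma weight_pos: "weight x > 0" if "x \<ge> 1"
  unfolding bd_weight_def
  by (intro divide_pos_pos prod_pos) (auto intro: birth_pos death_pos)

lemma weight_1 [simp]: "weight (Suc 0) = 1"
  by (simp add: bd_weight_def)

text \<open>
  The weights are reversible for the generator; this is what makes the flux below telescope.
\<close>

lemma detailed_balance:
  assumes "x \<ge> 1"
  shows "weight (Suc x) * d (Suc x) = weight x * b x"
proof -
  have "(\<Prod>k=1..<Suc x. b k) = (\<Prod>k=1..<x. b k) * b x"
    using assms by simp
  moreover have "(\<Prod>k=2..Suc x. d k) = (\<Prod>k=2..x. d k) * d (Suc x)"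
    using assms by simp
  ultimately show ?thesis
    using death_pos[of "Suc x"] by (simp add: bd_weight_def)
qed

text \<open>
  The conjugate of a discrete derivative: in these terms the generator is the divergence form
  \<open>K[f] x = (flux f x - flux f (x - 1)) / \<pi>\<^sub>x\<close> for \<open>x \<ge> 2\<close> (see \<open>flux_diff\<close>).
\<close>

definition flux :: "(nat \<Rightarrow> real) \<Rightarrow> nat \<Rightarrow> real" where
  "flux f x = weight x * b x * (f (x + 1) - f x)"

lemma flux_diff:
  assumes "x \<ge> 1"
  shows "flux f (Suc x) - flux f x = weight (Suc x) *
    (b (Suc x) * (f (x + 2) - f (x + 1)) + d (Suc x) * (f x - f (x + 1)))"
proof -
  have "flux f x = weight (Suc x) * d (Suc x) * (f (x + 1) - f x)"
    by (simp add: flux_def detailed_balance[OF assms])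
  then show ?thesis by (simp add: flux_def algebra_simps)
qed

text \<open>
  The scale function of the chain, normalised to be \<open>1\<close> at \<open>1\<close>; it is the harmonic function of
  constant flux \<open>d 1\<close>.
\<close>

definition natural_scale :: "nat \<Rightarrow> real" where
  "natural_scale x = (if x = 0 then 0 else 1 + d 1 * (\<Sum>k=1..<x. 1 / (weight k * b k)))"

lemma natural_scale_0 [simp]: "natural_scale 0 = 0"
  by (simp add: natural_scale_def)

lemma scale_Suc: "natural_scale (Suc x) = natural_scale x + d 1 * (1 / (weight x * b x))" if "x \<ge> 1"
  using that by (simp add: natural_scale_def algebra_simps)

lemma scale_ge_1:
  assumes "x \<ge> 1"
  shows "natural_scale x \<ge> 1"
proof -
  have "0 \<le> (\<Sum>k=1..<x. 1 / (weight k * b k))"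
  proof (rule sum_nonneg)
    show "0 \<le> 1 / (weight k * b k)" if "k \<in> {1..<x}" for k
      using that weight_pos[of k] birth_pos[of k] by simp
  qed
  then show ?thesis
    using assms death_pos[of 1] by (simp add: natural_scale_def)
qed

lemma flux_scale:
  assumes "x \<ge> 1"
  shows "flux natural_scale x = d 1"
proof -
  have "weight x * b x \<noteq> 0"
    using weight_pos[OF assms] birth_pos[OF assms] by simp
  moreover have "natural_scale (x + 1) - natural_scale x = d 1 * (1 / (weight x * b x))"
    using scale_Suc[OF assms] by simp
  ultimately show ?thesis
    by (simp add: flux_def)
qed

lemma scale_harmonic:
  assumes "x \<ge> 1"
  shows "b x * (natural_scale (x + 1) - natural_scale x) = d x * (natural_scale x - natural_scale (x - 1))"
proof (cases "x = 1")
  case True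
  then show ?thesis using birth_pos[of 1] by (simp add: natural_scale_def)
next
  case False
  \<comment> \<open>a function is harmonic at \<open>x \<ge> 2\<close> when its flux does not change there\<close>
  then obtain y where y: "x = Suc y" "y \<ge> 1" using assms by (cases x) auto
  then show ?thesis
    using flux_diff[of y natural_scale] flux_scale[of y] flux_scale[of x] weight_pos[of x]
    by (simp add: right_diff_distrib)
qed

text \<open>
  The equation determines \<open>f (x + 1)\<close> from \<open>f x\<close> and \<open>f (x - 1)\<close>, as \<open>b x > 0\<close>. Hence the
  difference of the two sides, which is harmonic and vanishes at \<open>0\<close> and \<open>1\<close>, vanishes everywhere.
\<close>

lemma harmonic_unique:
  fixes f :: "nat \<Rightarrow> real"
  assumes f0: "f 0 = 0"
    and harmonic: "\<And>x. x \<ge> 1 \<Longrightarrow> b x * (f (x + 1) - f x) = d x * (f x - f (x - 1))"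
  shows "f x = f 1 * natural_scale x"
proof -
  define g where "g = (\<lambda>x. f x - f 1 * natural_scale x)"
  have "g x = 0 \<and> g (Suc x) = 0" for x
  proof (induction x)
    case 0
    show ?case by (simp add: g_def f0 natural_scale_def)
  next
    case (Suc x)
    have "b (Suc x) * (g (Suc x + 1) - g (Suc x)) = d (Suc x) * (g (Suc x) - g (Suc x - 1))"
    proof -
      have "b (Suc x) * (g (Suc x + 1) - g (Suc x)) =
          b (Suc x) * (f (Suc x + 1) - f (Suc x)) - f 1 * (b (Suc x) * (natural_scale (Suc x + 1) - natural_scale (Suc x)))"
        unfolding g_def by (simp add: algebra_simps)
      also have "\<dots> = d (Suc x) * (f (Suc x) - f (Suc x - 1)) -
          f 1 * (d (Suc x) * (natural_scale (Suc x) - natural_scale (Suc x - 1)))"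
        using harmonic[of "Suc x"] scale_harmonic[of "Suc x"] by simp
      also have "\<dots> = d (Suc x) * (g (Suc x) - g (Suc x - 1))"
        unfolding g_def by (simp add: algebra_simps)
      finally show ?thesis .
    qed
    then show ?case
      using Suc birth_pos[of "Suc x"] by simp
  qed
  then have "g x = 0" by blast
  then show ?thesis unfolding g_def by (rule eq_iff_diff_eq_0[THEN iffD2])
qed

abbreviation absorbed :: "nat \<Rightarrow> nat \<Rightarrow> real" where
  "absorbed n x \<equiv> pmf (chain_law jump_kernel n x) 0"

lemma absorbed_at_0: "absorbed n 0 = 1"
proof -
  have "chain_law jump_kernel n 0 = return_pmf 0"
    by (induction n) (simp_all add: jump_kernel_def bind_return_pmf)
  then show ?thesis by simp
qed

lemma absorbed_Suc:
  assumes "x \<ge> 1"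
  shows "absorbed (Suc n) x =
    (b x * absorbed n (x + 1) + d x * absorbed n (x - 1)) / (b x + d x)"
  unfolding chain_law_Suc_first_step pmf_bind by (rule expectation_kernel[OF assms])

lemma absorbed_mono: "absorbed n x \<le> absorbed (Suc n) x"
proof (induction n arbitrary: x)
  case 0
  show ?case
    by (cases "x = 0") (use absorbed_at_0[of 1] in simp_all)
next
  case (Suc n)
  show ?case
  proof (cases "x = 0")
    case True
    then show ?thesis by (simp add: absorbed_at_0 del: chain_law.simps)
  next
    case False
    then have x: "x \<ge> 1" by simp
    show ?thesis
      unfolding absorbed_Suc[OF x, of n] absorbed_Suc[OF x, of "Suc n"]
      using birth_pos[OF x] death_pos[OF x]
      by (intro divide_right_mono add_mono mult_left_mono Suc.IH) auto
  qed
qed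

text \<open>
  A maximum principle. The scale function is harmonic and lies below \<open>S\<close> times the indicator of the
  positive integers; averaging that comparison over \<open>n\<close> steps of the chain leaves the scale function
  unchanged and turns the indicator into the probability of survival.
\<close>

lemma scale_le_not_absorbed:
  assumes "S > 0" and bound: "\<And>x. natural_scale x \<le> S"
  shows "natural_scale x \<le> S * (1 - absorbed n x)"
proof (induction n arbitrary: x)
  case 0
  show ?case using bound[of x] by (cases "x = 0") (simp_all add: natural_scale_def)
next
  case (Suc n)
  show ?case
  proof (cases "x = 0")
    case True
    then show ?thesis by (simp add: natural_scale_def absorbed_at_0 del: chain_law.simps)
  next
    case False
    then have x: "x \<ge> 1" by simp
    have pos: "b x + d x > 0" using birth_pos[OF x] death_pos[OF x] by simp
    have "(b x + d x) * natural_scale x = b x * natural_scale (x + 1) + d x * natural_scale (x - 1)"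
      using scale_harmonic[OF x] by (simp add: algebra_simps)
    also have "\<dots> \<le> b x * (S * (1 - absorbed n (x + 1))) + d x * (S * (1 - absorbed n (x - 1)))"
      using birth_pos[OF x] death_pos[OF x] by (intro add_mono mult_left_mono Suc.IH) auto
    also have "\<dots> = (b x + d x) * (S * (1 - absorbed (Suc n) x))"
      unfolding absorbed_Suc[OF x] using pos by (simp add: field_simps)
    finally show ?thesis using pos by simp
  qed
qed

text \<open>
  The probability \<open>u\<close> of never being absorbed is a multiple of the scale function, so its vanishing
  at one \<open>x \<ge> 1\<close> makes the multiple \<open>0\<close>. A bound \<open>S\<close> on the scale function would make survival
  possible, with probability at least \<open>natural_scale x / S\<close>.
\<close>

lemma absorption_dichotomy:
  assumes "x \<ge> 1" and lim: "(\<lambda>n. absorbed n x) \<longlonglongrightarrow> 1"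
  shows "(\<lambda>n. absorbed n y) \<longlonglongrightarrow> 1" and "\<exists>z. natural_scale z > S"
proof -
  define v where "v = (\<lambda>y. lim (\<lambda>n. absorbed n y))"
  have v: "(\<lambda>n. absorbed n y) \<longlonglongrightarrow> v y" for y
  proof -
    have "convergent (\<lambda>n. absorbed n y)"
      by (rule Bseq_mono_convergent[OF BseqI'[of _ 1]])
        (auto simp: pmf_le_1 intro: lift_Suc_mono_le[of "\<lambda>n. absorbed n y", OF absorbed_mono])
    then show ?thesis by (simp add: v_def convergent_LIMSEQ_iff)
  qed
  have v_x: "v x = 1" using v lim LIMSEQ_unique by blast
  have v_0: "v 0 = 1" using v[of 0] by (simp add: absorbed_at_0 LIMSEQ_const_iff)
  have harmonic: "b y * (v (y + 1) - v y) = d y * (v y - v (y - 1))" if y: "y \<ge> 1" for y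
  proof -
    have "(\<lambda>n. absorbed (Suc n) y) \<longlonglongrightarrow> (b y * v (y + 1) + d y * v (y - 1)) / (b y + d y)"
      unfolding absorbed_Suc[OF y]
      using birth_pos[OF y] death_pos[OF y] by (intro tendsto_intros v) auto
    moreover have "(\<lambda>n. absorbed (Suc n) y) \<longlonglongrightarrow> v y"
      using v by (rule LIMSEQ_Suc)
    ultimately have "v y = (b y * v (y + 1) + d y * v (y - 1)) / (b y + d y)"
      using LIMSEQ_unique by blast
    then show ?thesis
      using birth_pos[OF y] death_pos[OF y] by (simp add: field_simps)
  qed
  define u where "u = (\<lambda>y. 1 - v y)"
  have u: "u y = u 1 * natural_scale y" for y
  proof (rule harmonic_unique)
    show "u 0 = 0" by (simp add: u_def v_0)
    show "b y * (u (y + 1) - u y) = d y * (u y - u (y - 1))" if "y \<ge> 1" for y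
      using harmonic[OF that] by (simp add: u_def algebra_simps)
  qed
  have "u 1 = 0"
    using u[of x] scale_ge_1[OF assms(1)] by (auto simp: u_def v_x)
  then have "v y = 1" using u[of y] by (simp add: u_def)
  then show "(\<lambda>n. absorbed n y) \<longlonglongrightarrow> 1" using v by metis
  show "\<exists>z. natural_scale z > S"
  proof (rule ccontr)
    assume "\<not> (\<exists>z. natural_scale z > S)"
    then have S: "natural_scale z \<le> S" for z by (simp add: not_less)
    have "S > 0" using scale_ge_1[of 1] S[of 1] by linarith
    then have "natural_scale x \<le> S * (1 - absorbed n x)" for n
      using S by (rule scale_le_not_absorbed)
    moreover have "(\<lambda>n. S * (1 - absorbed n x)) \<longlonglongrightarrow> S * (1 - 1)"
      by (intro tendsto_intros lim)
    ultimately have "natural_scale x \<le> S * (1 - 1)"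
      by (intro LIMSEQ_le_const) auto
    then show False using scale_ge_1[OF assms(1)] by simp
  qed
qed

section \<open>The entrance boundary criterion\<close>

lemma resistance_sum_unbounded:
  assumes unbounded: "\<And>S. \<exists>z. natural_scale z > S"
  shows "\<exists>N. (\<Sum>k=1..<N. 1 / (weight k * b k)) > S"
proof -
  obtain z where z: "natural_scale z > 1 + d 1 * max S 0" using unbounded by blast
  have "d 1 * max S 0 \<ge> 0" using death_pos[of 1] by simp
  with z have "natural_scale z > 0" by linarith
  then have "z \<noteq> 0" by (metis natural_scale_0 less_irrefl)
  then have "d 1 * (\<Sum>k=1..<z. 1 / (weight k * b k)) > d 1 * max S 0"
    using z unfolding natural_scale_def by (simp only: if_False add_less_cancel_left)
  then have "(\<Sum>k=1..<z. 1 / (weight k * b k)) > max S 0"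
    using death_pos[of 1] by (simp only: mult_less_cancel_left_pos order_refl)
  then show ?thesis
    by (intro exI[of _ z]) linarith
qed

text \<open>
  The inner sum is at least its first term \<open>\<pi>\<^sub>1 = 1\<close>, and what remains is the divergent series of the
  increments of the scale function.
\<close>

lemma entrance_sum_infinite:
  assumes unbounded: "\<And>S. \<exists>z. natural_scale z > S"
  shows "(\<Sum>n. ennreal (1 / (weight (Suc n) * b (Suc n))) *
    (\<Sum>y=1..Suc n. ennreal (weight y))) = \<infinity>" (is "(\<Sum>n. ?f n) = \<infinity>")
proof -
  have lower: "ennreal (1 / (weight (Suc n) * b (Suc n))) \<le> ?f n" for n
  proof -
    have "(1::ennreal) = ennreal (weight 1)" by simp
    also have "\<dots> \<le> (\<Sum>y=1..Suc n. ennreal (weight y))"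
      by (rule member_le_sum) auto
    finally show ?thesis
      using mult_left_mono[of 1 _ "ennreal (1 / (weight (Suc n) * b (Suc n)))"] by simp
  qed
  have "ennreal S \<le> (\<Sum>n. ?f n)" for S
  proof -
    obtain N where N: "(\<Sum>k=1..<N. 1 / (weight k * b k)) > S"
      using resistance_sum_unbounded[OF unbounded] by blast
    have "(\<Sum>k=1..<N. 1 / (weight k * b k)) = (\<Sum>n<N-1. 1 / (weight (Suc n) * b (Suc n)))"
      by (rule sum.reindex_bij_witness[of _ Suc "\<lambda>k. k - 1"]) auto
    then have "ennreal S \<le> ennreal (\<Sum>n<N-1. 1 / (weight (Suc n) * b (Suc n)))"
      using N by (intro ennreal_leI) simp
    also have "\<dots> = (\<Sum>n<N-1. ennreal (1 / (weight (Suc n) * b (Suc n))))"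
      using weight_pos birth_pos by (intro sum_ennreal[symmetric]) (simp add: less_imp_le)
    also have "\<dots> \<le> (\<Sum>n<N-1. ?f n)" by (intro sum_mono lower)
    also have "\<dots> \<le> (\<Sum>n. ?f n)" by (rule sum_le_suminf) auto
    finally show ?thesis .
  qed
  then have "of_nat k \<le> (\<Sum>n. ?f n)" for k
    by (simp add: ennreal_of_nat_eq_real_of_nat)
  then show ?thesis
    by (metis ennreal_Ex_less_of_nat infinity_ennreal_def leD top.not_eq_extremum)
qed

text \<open>
  The drift inequality makes the flux of \<open>\<phi>\<close> decrease by at least \<open>lam * m * \<pi>\<^sub>x\<close> at each step. A
  nonnegative flux can therefore pay for the whole tail of the weights. The price, divided by
  \<open>\<pi>\<^sub>x b\<^sub>x\<close>, is an increment of the bounded function \<open>\<phi>\<close>.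
\<close>

lemma entrance_sum_finite:
  fixes \<phi> :: "nat \<Rightarrow> real"
  assumes unbounded: "\<And>S. \<exists>z. natural_scale z > S"
    and "lam > 0" "m > 0"
    and lower: "\<And>x. x \<ge> 1 \<Longrightarrow> m \<le> \<phi> x" and upper: "\<And>x. x \<ge> 1 \<Longrightarrow> \<phi> x \<le> C"
    and super: "\<And>x. x \<ge> 1 \<Longrightarrow> bd_operator b d \<phi> x \<le> - lam * \<phi> x"
  shows "(\<Sum>n. ennreal (1 / (weight (Suc n) * b (Suc n))) *
    (\<Sum>k. ennreal (weight (Suc n + 1 + k)))) < \<infinity>" (is "(\<Sum>n. ?f n) < \<infinity>")
proof -
  have flux_step: "flux \<phi> (Suc x) \<le> flux \<phi> x - lam * m * weight (Suc x)" if x: "x \<ge> 1" for x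
  proof -
    have "bd_operator b d \<phi> (Suc x) =
        b (Suc x) * (\<phi> (x + 2) - \<phi> (x + 1)) + d (Suc x) * (\<phi> x - \<phi> (x + 1))"
      using x by (simp add: bd_operator_def)
    moreover have "bd_operator b d \<phi> (Suc x) \<le> - lam * m"
    proof -
      have "lam * m \<le> lam * \<phi> (Suc x)"
        using lower[of "Suc x"] \<open>lam > 0\<close> by simp
      then show ?thesis using super[of "Suc x"] by simp
    qed
    ultimately have "flux \<phi> (Suc x) - flux \<phi> x \<le> weight (Suc x) * (- lam * m)"
      unfolding flux_diff[OF x] using weight_pos[of "Suc x"] by (intro mult_left_mono) auto
    then show ?thesis by (simp add: algebra_simps)
  qed
  have flux_sum: "flux \<phi> (x + n) + lam * m * (\<Sum>k<n. weight (x + 1 + k)) \<le> flux \<phi> x"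
    if x: "x \<ge> 1" for x n
  proof (induction n)
    case (Suc n)
    then show ?case using flux_step[of "x + n"] x by (simp add: algebra_simps)
  qed simp
  have increment: "\<phi> (Suc x) - \<phi> x = flux \<phi> x * (1 / (weight x * b x))" if "x \<ge> 1" for x
    using weight_pos[OF that] birth_pos[OF that] by (simp add: flux_def)
  have flux_nonneg: "flux \<phi> x \<ge> 0" if x: "x \<ge> 1" for x
  proof (rule ccontr)
    assume "\<not> flux \<phi> x \<ge> 0"
    \<comment> \<open>a flux at most \<open>- c\<close> from \<open>x\<close> on makes \<open>\<phi>\<close> fall by \<open>c\<close> times a divergent sum\<close>
    define c where "c = - flux \<phi> x"
    have "c > 0" using \<open>\<not> flux \<phi> x \<ge> 0\<close> by (simp add: c_def)
    have flux_c: "flux \<phi> (x + n) \<le> - c" for n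
    proof -
      have "0 \<le> lam * m * (\<Sum>k<n. weight (x + 1 + k))"
        using \<open>lam > 0\<close> \<open>m > 0\<close> weight_pos by (intro mult_nonneg_nonneg sum_nonneg less_imp_le) auto
      then show ?thesis using flux_sum[OF x, of n] by (simp add: c_def)
    qed
    let ?R = "\<lambda>N. \<Sum>k=1..<N. 1 / (weight k * b k)"
    have decrease: "\<phi> (x + n) + c * ?R (x + n) \<le> \<phi> x + c * ?R x" for n
    proof (induction n)
      case (Suc n)
      have "\<phi> (Suc (x + n)) - \<phi> (x + n) \<le> - c * (1 / (weight (x + n) * b (x + n)))"
        unfolding increment[of "x + n", OF trans_le_add1[OF x]]
        using weight_pos[of "x + n"] birth_pos[of "x + n"] x
        by (intro mult_right_mono flux_c) simp
      moreover have "?R (Suc (x + n)) = ?R (x + n) + 1 / (weight (x + n) * b (x + n))"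
        using x by simp
      ultimately show ?case using Suc.IH by (simp add: algebra_simps)
    qed simp
    obtain N where N: "?R N > (\<phi> x + c * ?R x) / c"
      using resistance_sum_unbounded[OF unbounded] by blast
    have "?R N \<le> ?R (x + N)"
      using weight_pos birth_pos by (intro sum_mono2) (auto intro!: less_imp_le)
    then have "c * ?R (x + N) > \<phi> x + c * ?R x"
      using N \<open>c > 0\<close> by (simp add: field_simps) (smt (verit) mult_left_mono)
    then have "\<phi> (x + N) < 0" using decrease[of N] by simp
    then show False using lower[of "x + N"] x \<open>m > 0\<close> by simp
  qed
  have tail: "(\<Sum>k. ennreal (weight (x + 1 + k))) \<le> ennreal (flux \<phi> x / (lam * m))"
    if x: "x \<ge> 1" for x
  proof (rule suminf_le_const)
    fix n
    have "lam * m * (\<Sum>k<n. weight (x + 1 + k)) \<le> flux \<phi> x"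
      using flux_sum[OF x, of n] flux_nonneg[of "x + n"] x by simp
    then have "(\<Sum>k<n. weight (x + 1 + k)) \<le> flux \<phi> x / (lam * m)"
      using \<open>lam > 0\<close> \<open>m > 0\<close> by (simp add: field_simps)
    moreover have "(\<Sum>k<n. ennreal (weight (x + 1 + k))) = ennreal (\<Sum>k<n. weight (x + 1 + k))"
      using weight_pos by (intro sum_ennreal) (simp add: less_imp_le)
    ultimately show "(\<Sum>k<n. ennreal (weight (x + 1 + k))) \<le> ennreal (flux \<phi> x / (lam * m))"
      by (simp add: ennreal_leI)
  qed simp
  have term_le: "?f n \<le> ennreal ((\<phi> (Suc (Suc n)) - \<phi> (Suc n)) / (lam * m))" for n
  proof -
    have "?f n \<le> ennreal (1 / (weight (Suc n) * b (Suc n))) * ennreal (flux \<phi> (Suc n) / (lam * m))"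
      using tail[of "Suc n"] by (intro mult_left_mono) auto
    also have "\<dots> = ennreal (1 / (weight (Suc n) * b (Suc n)) * (flux \<phi> (Suc n) / (lam * m)))"
      using weight_pos[of "Suc n"] birth_pos[of "Suc n"] by (intro ennreal_mult'[symmetric]) simp
    also have "1 / (weight (Suc n) * b (Suc n)) * (flux \<phi> (Suc n) / (lam * m)) =
        (\<phi> (Suc (Suc n)) - \<phi> (Suc n)) / (lam * m)"
      by (simp add: increment)
    finally show ?thesis .
  qed
  have "(\<Sum>n. ?f n) \<le> ennreal ((C - m) / (lam * m))"
  proof (rule suminf_le_const)
    fix N
    have "(\<Sum>n<N. ?f n) \<le> (\<Sum>n<N. ennreal ((\<phi> (Suc (Suc n)) - \<phi> (Suc n)) / (lam * m)))"
      by (intro sum_mono term_le)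
    also have "\<dots> = ennreal (\<Sum>n<N. (\<phi> (Suc (Suc n)) - \<phi> (Suc n)) / (lam * m))"
      using \<open>lam > 0\<close> \<open>m > 0\<close> flux_nonneg weight_pos birth_pos
      by (intro sum_ennreal) (simp add: increment less_imp_le)
    also have "(\<Sum>n<N. (\<phi> (Suc (Suc n)) - \<phi> (Suc n)) / (lam * m)) =
        (\<phi> (Suc N) - \<phi> 1) / (lam * m)"
      using sum_lessThan_telescope[of "\<lambda>n. \<phi> (Suc n)" N]
      by (simp add: sum_divide_distrib[symmetric])
    also have "ennreal \<dots> \<le> ennreal ((C - m) / (lam * m))"
      using lower[of 1] upper[of "Suc N"] \<open>lam > 0\<close> \<open>m > 0\<close>
      by (intro ennreal_leI divide_right_mono) auto
    finally show "(\<Sum>n<N. ?f n) \<le> ennreal ((C - m) / (lam * m))" .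
  qed simp
  then show ?thesis by (rule le_less_trans) simp
qed

end

text \<open>
  As the supremum is positive, an infimum \<open>0\<close> would make the quotient infinite; as the infimum is
  finite, so would an infinite supremum.
\<close>

lemma amplitude_finite_bounds:
  fixes \<phi> :: "nat \<Rightarrow> real"
  assumes pos: "\<And>x. x \<ge> 1 \<Longrightarrow> \<phi> x > 0" and "amplitude \<phi> < \<infinity>"
  obtains m C where "m > 0" "\<And>x. x \<ge> 1 \<Longrightarrow> m \<le> \<phi> x" "\<And>x. x \<ge> 1 \<Longrightarrow> \<phi> x \<le> C"
proof -
  define S where "S = (SUP x\<in>{1..}. ereal (\<phi> x))"
  define I where "I = (INF x\<in>{1..}. ereal (\<phi> x))"
  have fin: "S / I < \<infinity>" using assms(2) by (simp add: amplitude_def S_def I_def)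
  have S: "ereal (\<phi> x) \<le> S" if "x \<ge> 1" for x
    unfolding S_def using that by (intro SUP_upper) simp
  have I: "I \<le> ereal (\<phi> x)" if "x \<ge> 1" for x
    unfolding I_def using that by (intro INF_lower) simp
  have "I \<ge> 0"
    unfolding I_def using pos by (intro INF_greatest) (simp add: less_imp_le)
  moreover have "I \<noteq> \<infinity>" using I[of 1] by auto
  ultimately obtain m where m: "I = ereal m" "m \<ge> 0" by (cases I) auto
  have "S > 0" using S[of 1] pos[of 1] by (simp add: less_le_trans[of 0 "ereal (\<phi> 1)"])
  have "m \<noteq> 0"
    using fin \<open>S > 0\<close> by (auto simp: m divide_ereal_def)
  with m have "m > 0" by simp
  have "S \<noteq> \<infinity>"
    using fin \<open>m > 0\<close> by (auto simp: m)
  then obtain C where C: "S = ereal C" using \<open>S > 0\<close> by (cases S) auto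
  show thesis
    using that[of m C] \<open>m > 0\<close> S I by (simp add: m C)
qed

theorem proposition5:
  fixes b d :: "nat \<Rightarrow> real"
    and M :: "nat \<Rightarrow> 'w measure"
    and Y :: "nat \<Rightarrow> nat \<Rightarrow> 'w \<Rightarrow> nat"
    and H :: "nat \<Rightarrow> nat \<Rightarrow> 'w \<Rightarrow> ennreal"
  assumes "birth_death_rates b d"
    and "\<And>x. minimal_jump_process (M x) (bd_generator b d) x (Y x) (H x)"
    and "\<exists>x\<ge>1. AE w in M x. hitting_time (Y x) (H x) 0 w < \<infinity>"
  shows "(\<forall>x. AE w in M x. hitting_time (Y x) (H x) 0 w < \<infinity>) \<and>
         ((\<exists>lam>0. \<exists>\<phi> :: nat \<Rightarrow> real.
             (\<forall>x\<ge>1. \<phi> x > 0) \<and> amplitude \<phi> < \<infinity> \<and>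
             (\<forall>x\<ge>1. bd_operator b d \<phi> x \<le> - lam * \<phi> x))
          \<longrightarrow> entrance_boundary b d)"
proof -
  interpret birth_death b d by unfold_locales (rule assms(1))
  have hit: "(AE w in M x. hitting_time (Y x) (H x) 0 w < \<infinity>) \<longleftrightarrow> (\<lambda>n. absorbed n x) \<longlonglongrightarrow> 1" for x
  proof -
    interpret jump_process "M x" "bd_generator b d" x "Y x" "H x" jump_kernel
      by unfold_locales (rule assms(2), rule pmf_kernel)
    show ?thesis
    proof (rule AE_hitting_time_finite_iff)
      show "bd_generator b d 0 0 = 0" by (simp add: bd_generator_def rates_0)
      show "bd_generator b d y y \<noteq> 0" if "y \<noteq> 0" for y
        using that birth_pos[of y] death_pos[of y] by (simp add: bd_generator_def)
    qed
  qed
  obtain x where x: "x \<ge> 1" "(\<lambda>n. absorbed n x) \<longlonglongrightarrow> 1"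
    using assms(3) hit by blast
  note all = absorption_dichotomy(1)[OF x] and unbounded = absorption_dichotomy(2)[OF x]
  have "entrance_boundary b d"
    if lam: "lam > 0" and pos: "\<forall>x\<ge>1. \<phi> x > 0" and amp: "amplitude \<phi> < \<infinity>"
      and super: "\<forall>x\<ge>1. bd_operator b d \<phi> x \<le> - lam * \<phi> x" for lam \<phi>
  proof -
    obtain m C where "m > 0" "\<And>x. x \<ge> 1 \<Longrightarrow> m \<le> \<phi> x" "\<And>x. x \<ge> 1 \<Longrightarrow> \<phi> x \<le> C"
      using amplitude_finite_bounds[of \<phi>] pos amp by blast
    from entrance_sum_finite[OF unbounded lam this] super
    show ?thesis
      unfolding entrance_boundary_def Let_def using entrance_sum_infinite[OF unbounded] by simp
  qed
  then show ?thesis using hit all by blast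
qed

end
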